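(* Let $G$ be a finite abelian group and $H$ a proper subgroup of $G$. Then $H$ is a perfect code of $G$ if and only if $H_2$ is a $2$-pure subgroup of $G_2$, and this holds if and only if $H_2$ is a perfect code of $G_2$.
   Context: For a finite abelian group $G$, $G_2$ denotes its Sylow $2$-subgroup (elements of $2$-power order), and $G^2=\{g^2:g\in G\}$. A subgroup $H$ of an abelian group $G$ is $2$-pure if $G^2\cap H=H^2$. For a group $G$ and an inverse-closed subset $S\subseteq G$ with $e\notin S$, the Cayley graph $\mathrm{Cay}(G,S)$ has vertex set $G$, with distinct $x,y$ adjacent iff $yx^{-1}\in S$. A subset $C$ of the vertex set of a graph is a perfect code if it is independent and every vertex outside $C$ is adjacent to exactly one vertex of $C$. A subset $C$ of $G$ is a perfect code of $G$ if some Cayley graph $\mathrm{Cay}(G,S)$ admits $C$ as a perfect code. *)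

theory Defs
  imports "HOL-Algebra.Algebra" "Graph_Theory.Pair_Digraph"
begin

text \<open>In a finite abelian group the elements of 2-power order form the unique Sylow 2-subgroup.
  Only the underlying set is given here; the group is \<open>G\<lparr>carrier := two_part G\<rparr>\<close>.\<close>

definition two_part :: "('a, 'b) monoid_scheme \<Rightarrow> 'a set" where
  "two_part G = {g \<in> carrier G. \<exists>k::nat. group.ord G g = 2 ^ k}"

definition square_set :: "('a, 'b) monoid_scheme \<Rightarrow> 'a set \<Rightarrow> 'a set" where
  "square_set G A = {g [^]\<^bsub>G\<^esub> (2::nat) | g. g \<in> A}"

definition two_pure :: "'a set \<Rightarrow> ('a, 'b) monoid_scheme \<Rightarrow> bool" where
  "two_pure H G \<longleftrightarrow> subgroup H G \<and> square_set G (carrier G) \<inter> H = square_set G H"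

text \<open>Undirected graphs are represented, as in \<^locale>\<open>pair_graph\<close>, by symmetric loop-free
  digraphs: each edge gives two opposite arcs.\<close>

definition cayley_graph :: "('a, 'b) monoid_scheme \<Rightarrow> 'a set \<Rightarrow> 'a pair_pre_digraph" where
  "cayley_graph G S =
     \<lparr>pverts = carrier G,
      parcs = {(x, y). x \<in> carrier G \<and> y \<in> carrier G \<and> x \<noteq> y \<and> y \<otimes>\<^bsub>G\<^esub> inv\<^bsub>G\<^esub> x \<in> S}\<rparr>"

definition independent_set :: "'a pair_pre_digraph \<Rightarrow> 'a set \<Rightarrow> bool" where
  "independent_set \<Gamma> C \<longleftrightarrow> C \<subseteq> pverts \<Gamma> \<and> (\<forall>x\<in>C. \<forall>y\<in>C. (x, y) \<notin> parcs \<Gamma>)"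

definition graph_perfect_code :: "'a pair_pre_digraph \<Rightarrow> 'a set \<Rightarrow> bool" where
  "graph_perfect_code \<Gamma> C \<longleftrightarrow>
     independent_set \<Gamma> C \<and> (\<forall>v \<in> pverts \<Gamma> - C. \<exists>!c. c \<in> C \<and> (v, c) \<in> parcs \<Gamma>)"

definition connection_set :: "('a, 'b) monoid_scheme \<Rightarrow> 'a set \<Rightarrow> bool" where
  "connection_set G S \<longleftrightarrow> S \<subseteq> carrier G \<and> \<one>\<^bsub>G\<^esub> \<notin> S \<and> (\<forall>s\<in>S. inv\<^bsub>G\<^esub> s \<in> S)"

definition group_perfect_code :: "('a, 'b) monoid_scheme \<Rightarrow> 'a set \<Rightarrow> bool" where
  "group_perfect_code G C \<longleftrightarrow>
     (\<exists>S. connection_set G S \<and> graph_perfect_code (cayley_graph G S) C)"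

lemma pair_graph_cayley_graph:
  assumes "group G" "finite (carrier G)" "connection_set G S"
  shows "pair_graph (cayley_graph G S)"
proof -
  interpret group G by fact
  have sym: "(y, x) \<in> parcs (cayley_graph G S)" if "(x, y) \<in> parcs (cayley_graph G S)" for x y
  proof -
    from that have xy: "x \<in> carrier G" "y \<in> carrier G" "x \<noteq> y"
      and "y \<otimes>\<^bsub>G\<^esub> inv\<^bsub>G\<^esub> x \<in> S"
      by (auto simp: cayley_graph_def)
    then have "inv\<^bsub>G\<^esub> (y \<otimes>\<^bsub>G\<^esub> inv\<^bsub>G\<^esub> x) \<in> S"
      using assms(3) by (auto simp: connection_set_def)
    with xy show ?thesis by (auto simp: cayley_graph_def inv_mult_group)
  qed
  have "finite (parcs (cayley_graph G S))"
    by (rule finite_subset[of _ "carrier G \<times> carrier G"]) (auto simp: cayley_graph_def assms(2))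
  moreover have "finite (pverts (cayley_graph G S))"
    by (simp add: cayley_graph_def assms(2))
  moreover have "fst e \<in> pverts (cayley_graph G S) \<and> snd e \<in> pverts (cayley_graph G S) \<and> fst e \<noteq> snd e"
    if "e \<in> parcs (cayley_graph G S)" for e
    using that unfolding cayley_graph_def by auto
  moreover have "symmetric (with_proj (cayley_graph G S))"
    unfolding symmetric_def with_proj_simps by (rule symI) (rule sym)
  ultimately show ?thesis
    by unfold_locales blast+
qed

end

theory Submission
  imports Defs
begin

text \<open>For an arbitrary abelian group, a subgroup \<open>H\<close> is a perfect code iff it is 2-pure. If \<open>H\<close> is
  a perfect code and \<open>g\<^sup>2 \<in> H\<close> with \<open>g \<notin> H\<close>, and \<open>c\<close> is the neighbour of \<open>g\<close> in \<open>H\<close>, then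
  \<open>g\<^sup>2c\<^sup>-\<^sup>1\<close> is a neighbour too, so by uniqueness \<open>g\<^sup>2 = c\<^sup>2\<close>. Conversely, a perfect code amounts to an inverse-closed
  transversal of the nontrivial cosets; the only obstruction to choosing it in inverse pairs are the
  cosets equal to their own inverse, and 2-purity provides an involution in each of these.
  2-purity passes between \<open>H \<le> G\<close> and the Sylow 2-subgroups because \<open>g\<^sup>2\<close> and \<open>g\<^sup>2\<^sup>m\<close> differ by a
  square of \<open>H\<close> for odd \<open>m\<close>.\<close>

context comm_group
begin

section \<open>Subgroups and 2-purity\<close>

lemma subgroup_nat_pow_closed:
  assumes "subgroup H G" "h \<in> H"
  shows "h [^] (n::nat) \<in> H"
  using assms by (induction n) (auto intro: subgroup.one_closed subgroup.m_closed)

lemma subgroup_is_comm_group: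
  assumes "subgroup H G"
  shows "comm_group (G\<lparr>carrier := H\<rparr>)"
  using group.group_comm_groupI[OF subgroup_imp_group[OF assms]] subgroup.mem_carrier[OF assms]
    m_comm by simp

text \<open>Squares of elements of \<open>H\<close> are squares in \<open>G\<close> and lie in
  \<open>H\<close> anyway, so only the inclusion of \<open>G\<close>-squares lying in
  \<open>H\<close> among the squares of \<open>H\<close> has content.\<close>

lemma two_pure_iff:
  assumes "subgroup H G"
  shows "two_pure H G \<longleftrightarrow>
    (\<forall>g\<in>carrier G. g [^] (2::nat) \<in> H \<longrightarrow> (\<exists>h\<in>H. g [^] (2::nat) = h [^] (2::nat)))"
  using assms subgroup.subset[OF assms] subgroup_nat_pow_closed
  unfolding two_pure_def square_set_def by blast

section \<open>From perfect codes to 2-purity\<close>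

lemma two_pure_if_perfect_code:
  assumes H: "subgroup H G" and code: "group_perfect_code G H"
  shows "two_pure H G"
  unfolding two_pure_iff[OF H]
proof (intro ballI impI)
  interpret H: subgroup H G by (rule H)
  fix g assume g: "g \<in> carrier G" "g [^] (2::nat) \<in> H"
  show "\<exists>h\<in>H. g [^] (2::nat) = h [^] (2::nat)"
  proof (cases "g \<in> H")
    case False
    obtain S where S: "\<forall>s\<in>S. inv s \<in> S"
      and ex1: "\<exists>!c. c \<in> H \<and> (g, c) \<in> parcs (cayley_graph G S)"
      using code g False
      unfolding group_perfect_code_def graph_perfect_code_def connection_set_def
      by (auto simp: cayley_graph_def)
    have arc: "(g, c) \<in> parcs (cayley_graph G S) \<longleftrightarrow> c \<otimes> inv g \<in> S" if "c \<in> H" for c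
      using that g False by (auto simp: cayley_graph_def)
    obtain c where c: "c \<in> H" "c \<otimes> inv g \<in> S"
      using ex1 arc by blast
    \<comment> \<open>Inverting the connecting element \<open>c \<otimes> inv g\<close> gives
      \<open>g \<otimes> inv c\<close>, which is \<open>?d \<otimes> inv g\<close>; hence
      \<open>?d\<close> is again a neighbour of \<open>g\<close>, and it lies in \<open>H\<close>
      because \<open>g\<close> squared does.\<close>
    let ?d = "g [^] (2::nat) \<otimes> inv c"
    have d: "?d \<in> H" using c g by simp
    have "?d \<otimes> inv g = inv c \<otimes> g"
      using c g by (subst inv_solve_right') (simp_all add: numeral_2_eq_2 m_ac)
    also have "\<dots> = inv (c \<otimes> inv g)"
      using c g by (simp add: inv_mult)
    finally have "?d \<otimes> inv g = inv (c \<otimes> inv g)" .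
    then have "?d \<otimes> inv g \<in> S" using S c by simp
    then have "?d = c" using ex1 arc c d by blast
    then have "g [^] (2::nat) = c \<otimes> c"
      using c g by (metis H.mem_carrier inv_solve_right' nat_pow_closed)
    then show ?thesis using c by (auto simp: numeral_2_eq_2)
  qed auto
qed

section \<open>From 2-purity to perfect codes\<close>

text \<open>Quotients of elements of \<open>H\<close> stay in \<open>H\<close>, which
  \<open>S\<close> avoids, so \<open>H\<close> is independent. The neighbours of \<open>v\<close> in
  \<open>H\<close> are the products \<open>s \<otimes> v\<close> in \<open>H\<close> with
  \<open>s\<close> in \<open>S\<close>; they correspond to the elements of \<open>S\<close> in the
  coset of \<open>inv v\<close>.\<close>

lemma perfect_code_if_transversal:
  assumes H: "subgroup H G"
    and S: "S \<subseteq> carrier G - H" "\<And>s. s \<in> S \<Longrightarrow> inv s \<in> S"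
    and ex1: "\<And>g. g \<in> carrier G - H \<Longrightarrow> \<exists>!s. s \<in> S \<and> s \<otimes> inv g \<in> H"
  shows "group_perfect_code G H"
proof -
  interpret H: subgroup H G by (rule H)
  have "connection_set G S"
    using S unfolding connection_set_def by auto
  moreover have "independent_set (cayley_graph G S) H"
    using S(1) H.subset unfolding independent_set_def cayley_graph_def by auto
  moreover have "\<exists>!c. c \<in> H \<and> (v, c) \<in> parcs (cayley_graph G S)" if v: "v \<in> carrier G - H" for v
  proof -
    have "inv v \<in> carrier G - H"
      using v by (metis DiffD1 DiffD2 DiffI H.m_inv_closed inv_closed inv_inv)
    then have "\<exists>!s. s \<in> S \<and> s \<otimes> v \<in> H"
      using ex1[of "inv v"] v by simp
    then obtain s where s: "s \<in> S" "s \<otimes> v \<in> H"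
      and uniq: "\<And>t. t \<in> S \<Longrightarrow> t \<otimes> v \<in> H \<Longrightarrow> t = s"
      by blast
    show ?thesis
    proof (rule ex1I[of _ "s \<otimes> v"])
      show "s \<otimes> v \<in> H \<and> (v, s \<otimes> v) \<in> parcs (cayley_graph G S)"
        using s v S(1) by (auto simp: cayley_graph_def m_assoc)
    next
      fix c assume c: "c \<in> H \<and> (v, c) \<in> parcs (cayley_graph G S)"
      then have "c \<otimes> inv v \<in> S" by (simp add: cayley_graph_def)
      moreover have "c \<otimes> inv v \<otimes> v = c" using c v by (auto simp: m_assoc)
      ultimately show "c = s \<otimes> v" using uniq[of "c \<otimes> inv v"] c by auto
    qed
  qed
  moreover have "pverts (cayley_graph G S) = carrier G"
    by (simp add: cayley_graph_def)
  ultimately show ?thesis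
    unfolding group_perfect_code_def graph_perfect_code_def by metis
qed

lemma perfect_code_if_two_pure:
  assumes H: "subgroup H G" and pure: "two_pure H G"
  shows "group_perfect_code G H"
proof -
  interpret H: subgroup H G by (rule H)
  \<comment> \<open>Choosing from the set \<open>U g\<close> instead of from a single coset gives
    both cosets of an inverse pair the same choice; by \<open>U_eq\<close>, any member of
    \<open>U g\<close> yields the same set.\<close>
  define U where "U g = (H #> g) \<union> (H #> inv g)" for g
  have coset_iff: "x \<in> H #> g \<longleftrightarrow> x \<in> carrier G \<and> x \<otimes> inv g \<in> H" if "g \<in> carrier G" for x g
    using H.rcos_module[OF is_group that] r_coset_subset_G[OF H.subset that] by blast
  have coset_inv: "H #> inv x = H #> inv y"
    if "x \<in> carrier G" "y \<in> carrier G" "H #> x = H #> y" for x y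
  proof -
    have "x \<otimes> inv y \<in> H"
      using that coset_iff rcos_self[OF _ H] by blast
    then have "inv (x \<otimes> inv y) \<in> H" by simp
    then have "inv x \<in> H #> inv y"
      using that by (simp add: coset_iff inv_mult)
    then show ?thesis using repr_independence[OF _ _ H] that(2) by simp
  qed
  have U_eq: "U x = U g" if "g \<in> carrier G" "x \<in> U g" for x g
  proof -
    have x: "x \<in> carrier G"
      using that coset_iff unfolding U_def by auto
    have "H #> x = H #> g \<or> H #> x = H #> inv g"
      using that repr_independence[OF _ _ H] unfolding U_def by auto
    then show ?thesis
      using coset_inv[OF x that(1)] coset_inv[OF x inv_closed[OF that(1)]] that(1)
      unfolding U_def by auto
  qed
  text \<open>The chosen element of a pair of mutually inverse cosets, an involution if they coincide.\<close>
  define a where "a P = (SOME s. s \<in> P \<and> (s [^] (2::nat) \<in> H \<longrightarrow> inv s = s))" for P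
  define S where "S = (\<Union>g\<in>carrier G - H. {a (U g), inv (a (U g))})"
  have a: "a (U g) \<in> U g" "a (U g) [^] (2::nat) \<in> H \<Longrightarrow> inv (a (U g)) = a (U g)"
    if g: "g \<in> carrier G" for g
  proof -
    have gU: "g \<in> U g" using rcos_self[OF g H] by (simp add: U_def)
    have "\<exists>s. s \<in> U g \<and> (s [^] (2::nat) \<in> H \<longrightarrow> inv s = s)"
    proof (cases "g [^] (2::nat) \<in> H")
      case True
      then obtain h where h: "h \<in> H" "g [^] (2::nat) = h [^] (2::nat)"
        using pure g unfolding two_pure_iff[OF H] by blast
      \<comment> \<open>Dividing \<open>g\<close> by a root \<open>h\<close> in \<open>H\<close> of
        its square stays in the coset of \<open>g\<close> and gives an element whose square is
        trivial.\<close>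
      let ?s = "inv h \<otimes> g"
      have s: "?s \<in> carrier G" using h g by simp
      have "?s \<otimes> ?s = inv (h [^] (2::nat)) \<otimes> g [^] (2::nat)"
        using h(1) g by (simp add: numeral_2_eq_2 inv_mult m_ac)
      then have "?s \<otimes> ?s = \<one>" using h by simp
      then have "inv ?s = ?s" using s by (metis inv_equality)
      moreover have "?s \<in> U g" using h g by (auto simp: U_def r_coset_def)
      ultimately show ?thesis by blast
    qed (use gU in blast)
    from someI_ex[OF this]
    show "a (U g) \<in> U g" "a (U g) [^] (2::nat) \<in> H \<Longrightarrow> inv (a (U g)) = a (U g)"
      unfolding a_def by blast+
  qed
  have U_carrier: "x \<in> carrier G" if "x \<in> U g" "g \<in> carrier G" for x g
    using that coset_iff unfolding U_def by auto
  have U_inv: "inv x \<in> H #> inv g" if "x \<in> H #> g" "g \<in> carrier G" for x g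
    using that coset_iff coset_inv repr_independence[OF that(1,2) H] rcos_self[OF _ H]
    by (metis inv_closed)
  have inv_U: "inv x \<in> U g" if "x \<in> U g" "g \<in> carrier G" for x g
    using that U_inv[of x g] U_inv[of x "inv g"] unfolding U_def by auto
  show ?thesis
  proof (rule perfect_code_if_transversal[OF H, of S])
    have notH: "x \<notin> H" if "x \<in> U g" "g \<in> carrier G - H" for x g
    proof
      assume "x \<in> H"
      then have "U x = H" unfolding U_def by (simp add: H coset_join2)
      moreover have "U x = U g" using U_eq that by blast
      moreover have "g \<in> U g" using that rcos_self[OF _ H] by (simp add: U_def)
      ultimately show False using that by blast
    qed
    show "S \<subseteq> carrier G - H"
      using a(1) inv_U U_carrier notH unfolding S_def by blast
    show "inv s \<in> S" if "s \<in> S" for s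
      using that a(1) U_carrier unfolding S_def by fastforce
  next
    fix g assume g: "g \<in> carrier G - H"
    let ?a = "a (U g)"
    have aU: "?a \<in> U g" and aG: "?a \<in> carrier G"
      using g a(1) U_carrier by blast+
    \<comment> \<open>An element of \<open>S\<close> arising from some \<open>g'\<close> lies in
      both \<open>U g'\<close> and \<open>U g\<close>; these sets then coincide, and so do the
      elements chosen from them.\<close>
    have S_coset: "s \<in> {?a, inv ?a}" if "s \<in> S" "s \<in> H #> g" for s
    proof -
      obtain g' where g': "g' \<in> carrier G - H" "s \<in> {a (U g'), inv (a (U g'))}"
        using \<open>s \<in> S\<close> unfolding S_def by blast
      then have "s \<in> U g'" using a(1) inv_U by blast
      then have "U s = U g'" using U_eq g' by blast
      moreover have "U s = U g" using U_eq g that(2) unfolding U_def by blast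
      ultimately show ?thesis using g' by simp
    qed
    \<comment> \<open>If both candidates lie in the coset of \<open>g\<close>, that coset is its own
      inverse and contains \<open>?a\<close> and \<open>inv ?a\<close>, so the square of
      \<open>?a\<close> is in \<open>H\<close> and the choice of \<open>a\<close> forces them to be
      equal.\<close>
    have unique: "inv ?a = ?a" if "?a \<in> H #> g" "inv ?a \<in> H #> g"
    proof -
      have "H #> inv ?a = H #> ?a"
        using that g repr_independence[OF _ _ H] by (metis DiffD1)
      then have "?a \<in> H #> inv ?a" using rcos_self[OF aG H] by simp
      then have "?a \<otimes> ?a \<in> H" using coset_iff[of "inv ?a" ?a] aG by simp
      then show ?thesis using a(2) g aG by (simp add: numeral_2_eq_2)
    qed
    \<comment> \<open>Inversion swaps the two cosets that make up \<open>U g\<close>.\<close>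
    have "?a \<in> H #> g \<or> inv ?a \<in> H #> g"
      using aU U_inv[of ?a "inv g"] g unfolding U_def by auto
    then have "\<exists>!s. s \<in> S \<and> s \<in> H #> g"
      using S_coset unique g unfolding S_def by (smt (verit) UN_iff insert_iff singletonD)
    moreover have "s \<in> S \<Longrightarrow> s \<in> carrier G" for s
      using a(1) inv_U U_carrier unfolding S_def by blast
    ultimately show "\<exists>!s. s \<in> S \<and> s \<otimes> inv g \<in> H"
      using coset_iff[of g] g by (smt (verit) DiffD1)
  qed
qed

theorem perfect_code_iff_two_pure:
  assumes "subgroup H G"
  shows "group_perfect_code G H \<longleftrightarrow> two_pure H G"
  using assms two_pure_if_perfect_code perfect_code_if_two_pure by blast

section \<open>The Sylow 2-subgroup\<close>

text \<open>The divisors of a power of 2 are powers of 2. Unlike the order, the power condition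
  transfers directly to a subgroup, since powers are computed there as in \<open>G\<close>.\<close>

lemma mem_two_part_iff: "x \<in> two_part G \<longleftrightarrow> x \<in> carrier G \<and> (\<exists>k::nat. x [^] (2 ^ k :: nat) = \<one>)"
proof -
  have "(\<exists>k. ord x = 2 ^ k) \<longleftrightarrow> (\<exists>k::nat. x [^] (2 ^ k :: nat) = \<one>)" if "x \<in> carrier G"
    unfolding pow_eq_id[OF that] divides_primepow_nat[OF two_is_prime_nat] by blast
  then show ?thesis unfolding two_part_def by blast
qed

lemma subgroup_two_part: "subgroup (two_part G) G"
proof (rule subgroupI)
  show "two_part G \<subseteq> carrier G" by (auto simp: two_part_def)
  have "\<one> \<in> two_part G" by (simp add: mem_two_part_iff)
  then show "two_part G \<noteq> {}" by blast
  show "inv x \<in> two_part G" if "x \<in> two_part G" for x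
    using that by (auto simp: mem_two_part_iff nat_pow_inv)
  show "x \<otimes> y \<in> two_part G" if xy: "x \<in> two_part G" "y \<in> two_part G" for x y
  proof -
    obtain k l :: nat where x: "x \<in> carrier G" "x [^] (2 ^ k :: nat) = \<one>"
      and y: "y \<in> carrier G" "y [^] (2 ^ l :: nat) = \<one>"
      using xy by (auto simp: mem_two_part_iff)
    \<comment> \<open>\<open>2 ^ (k + l)\<close> is a common multiple of the two exponents that kill
      \<open>x\<close> and \<open>y\<close>.\<close>
    have "x [^] (2 ^ (k + l) :: nat) = (x [^] (2 ^ k :: nat)) [^] (2 ^ l :: nat)"
      "y [^] (2 ^ (k + l) :: nat) = (y [^] (2 ^ l :: nat)) [^] (2 ^ k :: nat)"
      using x(1) y(1) by (simp_all add: nat_pow_pow power_add mult.commute)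
    then have "(x \<otimes> y) [^] (2 ^ (k + l) :: nat) = \<one>"
      using x y by (simp add: nat_pow_distrib)
    then show ?thesis using x y by (auto simp: mem_two_part_iff)
  qed
qed

lemma two_part_subgroup_eq:
  assumes "subgroup H G"
  shows "two_part (G\<lparr>carrier := H\<rparr>) = two_part G \<inter> H"
proof -
  interpret H: comm_group "G\<lparr>carrier := H\<rparr>"
    using assms by (rule subgroup_is_comm_group)
  show ?thesis
    using subgroup.subset[OF assms] mem_two_part_iff H.mem_two_part_iff
    by (auto simp: nat_pow_consistent[symmetric])
qed

text \<open>This keeps a square root found in \<open>H\<close> inside the Sylow 2-subgroup.\<close>

lemma two_part_if_square:
  assumes "h \<in> carrier G" "h [^] (2::nat) \<in> two_part G"
  shows "h \<in> two_part G"
proof -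
  obtain k :: nat where "(h [^] (2::nat)) [^] (2 ^ k :: nat) = \<one>"
    using assms by (auto simp: mem_two_part_iff)
  then have "h [^] (2 ^ Suc k :: nat) = \<one>"
    using assms by (simp add: nat_pow_pow)
  then show ?thesis using assms unfolding mem_two_part_iff by blast
qed

text \<open>Raising \<open>g\<close> to the odd part of its order leaves only 2-power order.\<close>

lemma odd_pow_in_two_part:
  assumes "finite (carrier G)" "g \<in> carrier G"
  obtains j :: nat where "g [^] (2 * j + 1) \<in> two_part G"
proof -
  \<comment> \<open>The value 0 would stand for infinite order, where there is no odd part to split
    off.\<close>
  have "ord g \<noteq> 0" using assms ord_ge_1[of g] by simp
  then obtain m where m: "ord g = 2 ^ multiplicity 2 (ord g) * m" "odd m"
    using multiplicity_decompose'[of "ord g" 2] by auto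
  obtain j where j: "m = 2 * j + 1" using m(2) by (rule oddE)
  have "(g [^] m) [^] (2 ^ multiplicity 2 (ord g) :: nat) = \<one>"
    using assms m(1) by (metis mult.commute nat_pow_pow pow_ord_eq_1)
  then have "g [^] m \<in> two_part G"
    using assms unfolding mem_two_part_iff by blast
  then show ?thesis using that j by blast
qed

section \<open>2-purity in the group and in its Sylow 2-subgroup\<close>

lemma two_pure_two_part_iff:
  assumes fin: "finite (carrier G)" and H: "subgroup H G"
  shows "two_pure (two_part G \<inter> H) (G\<lparr>carrier := two_part G\<rparr>) \<longleftrightarrow> two_pure H G"
proof -
  interpret H: subgroup H G by (rule H)
  interpret T: subgroup "two_part G" G by (rule subgroup_two_part)
  interpret T: comm_group "G\<lparr>carrier := two_part G\<rparr>"
    using subgroup_two_part by (rule subgroup_is_comm_group)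
  have sub: "subgroup (two_part G \<inter> H) (G\<lparr>carrier := two_part G\<rparr>)"
    using subgroup_incl[OF subgroups_Inter_pair[OF subgroup_two_part H] subgroup_two_part] by simp
  have "two_pure (two_part G \<inter> H) (G\<lparr>carrier := two_part G\<rparr>) \<longleftrightarrow>
    (\<forall>g\<in>two_part G. g [^] (2::nat) \<in> H \<longrightarrow>
      (\<exists>h\<in>two_part G \<inter> H. g [^] (2::nat) = h [^] (2::nat)))" (is "_ \<longleftrightarrow> ?P")
    unfolding T.two_pure_iff[OF sub]
    by (auto simp: nat_pow_consistent[symmetric] subgroup_nat_pow_closed[OF subgroup_two_part])
  also have "\<dots> \<longleftrightarrow> two_pure H G"
  proof
    assume ?P
    show "two_pure H G"
      unfolding two_pure_iff[OF H]
    proof (intro ballI impI)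
      fix g assume g: "g \<in> carrier G" "g [^] (2::nat) \<in> H"
      obtain j :: nat where j: "g [^] (2 * j + 1) \<in> two_part G"
        using odd_pow_in_two_part[OF fin g(1)] .
      \<comment> \<open>The square of \<open>?u\<close> is the factor by which the square of the odd
        power of \<open>g\<close> differs from that of \<open>g\<close>; as \<open>?u\<close> is in
        \<open>H\<close>, a root in \<open>H\<close> of the former is corrected to a root of the
        latter by \<open>inv ?u\<close>.\<close>
      let ?u = "(g [^] (2::nat)) [^] j"
      have u: "?u \<in> H" using g subgroup_nat_pow_closed[OF H] by blast
      have sq: "(g [^] (2 * j + 1)) [^] (2::nat) = ?u [^] (2::nat) \<otimes> g [^] (2::nat)"
        using g by (simp only: nat_pow_pow nat_pow_mult nat_pow_closed) (simp add: algebra_simps)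
      then have "(g [^] (2 * j + 1)) [^] (2::nat) \<in> H"
        using u g(2) subgroup_nat_pow_closed[OF H] by simp
      then obtain h where h: "h \<in> H" "(g [^] (2 * j + 1)) [^] (2::nat) = h [^] (2::nat)"
        using \<open>?P\<close> j by blast
      have "g [^] (2::nat) = inv (?u [^] (2::nat)) \<otimes> h [^] (2::nat)"
        using sq h g u by (metis H.mem_carrier inv_solve_left nat_pow_closed)
      also have "\<dots> = (inv ?u \<otimes> h) [^] (2::nat)"
        using h(1) g u by (simp add: nat_pow_distrib nat_pow_inv)
      finally show "\<exists>h\<in>H. g [^] (2::nat) = h [^] (2::nat)"
        using h u by blast
    qed
  next
    assume pure: "two_pure H G"
    show ?P
    proof (intro ballI impI)
      fix g assume g: "g \<in> two_part G" "g [^] (2::nat) \<in> H"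
      then obtain h where h: "h \<in> H" "g [^] (2::nat) = h [^] (2::nat)"
        using pure unfolding two_pure_iff[OF H] by (meson T.mem_carrier)
      moreover have "g [^] (2::nat) \<in> two_part G"
        using g subgroup_nat_pow_closed[OF subgroup_two_part] by blast
      ultimately show "\<exists>h\<in>two_part G \<inter> H. g [^] (2::nat) = h [^] (2::nat)"
        using two_part_if_square[of h] by auto
    qed
  qed
  finally show ?thesis .
qed

end

theorem theorem1p5:
  fixes G :: "('a, 'b) monoid_scheme" and H :: "'a set"
  assumes "comm_group G" and "finite (carrier G)"
    and "subgroup H G" and "H \<noteq> carrier G"
  shows "(group_perfect_code G H
            \<longleftrightarrow> two_pure (two_part (G\<lparr>carrier := H\<rparr>)) (G\<lparr>carrier := two_part G\<rparr>))
       \<and> (two_pure (two_part (G\<lparr>carrier := H\<rparr>)) (G\<lparr>carrier := two_part G\<rparr>)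
            \<longleftrightarrow> group_perfect_code (G\<lparr>carrier := two_part G\<rparr>) (two_part (G\<lparr>carrier := H\<rparr>)))"
proof -
  interpret comm_group G by fact
  \<comment> \<open>The equivalence of perfect codes and 2-pure subgroups is applied twice, in
    \<open>G\<close> and in its Sylow 2-subgroup; the transfer of 2-purity links the two.\<close>
  interpret T: comm_group "G\<lparr>carrier := two_part G\<rparr>"
    using subgroup_two_part by (rule subgroup_is_comm_group)
  have "subgroup (two_part G \<inter> H) (G\<lparr>carrier := two_part G\<rparr>)"
    using subgroup_incl[OF subgroups_Inter_pair[OF subgroup_two_part assms(3)] subgroup_two_part]
    by simp
  then show ?thesis
    using assms(2,3)
    by (simp add: two_part_subgroup_eq two_pure_two_part_iff perfect_code_iff_two_pure
        T.perfect_code_iff_two_pure)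
qed

end
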